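(* Let $\text{D-Opt}(A,B,s)$ be an arbitrary 0/1 D-Opt instance with $A\in\mathbb{R}^{n\times m}$, $B\in\mathbb{R}^{q\times m}$, and let $\mathrm{MESP}(C,n-s):=\mathcal{M}(\text{D-Opt}(A,B,s))$, so $C:=I_n-A(A^\top A+B^\top B)^{-1}A^\top$. Let $N:=\{1,\dots,n\}$. 1. Let $s\ge 1$ and $i\in N$. Put $B^{(i)}:=\begin{pmatrix} A_{i\cdot} \\ B \end{pmatrix}$ and $\mathrm{MESP}(C_1,n-s):=\mathcal{M}(\text{D-Opt}(A_{(N\setminus i)\cdot},B^{(i)},s-1))$. Then $\mathrm{MESP}(C_1,n-s)+\operatorname{ldet}\left(A_{(N\setminus i)\cdot}^\top A_{(N\setminus i)\cdot}+(B^{(i)})^\top B^{(i)}\right)$ and $\mathrm{MESP}(C_{N\setminus i,N\setminus i},n-s)+\operatorname{ldet}(A^\top A+B^\top B)$ are exactly the same MESP instance with the same constant added to the objective; i.e. $C_1=C_{N\setminus i,N\setminus i}$ and the two added constants are equal. 2. Let $j\in N$ be such that $\begin{pmatrix} A_{(N\setminus j)\cdot} \\ B \end{pmatrix}$ has full column rank $m$ and $s\le n-2$ (so that the reduced D-Opt instance is well defined). Put $\mathrm{MESP}(C_0,n-1-s):=\mathcal{M}(\text{D-Opt}(A_{(N\setminus j)\cdot},B,s))$. Then $\mathrm{MESP}(C_0,n-1-s)+\operatorname{ldet}(A_{(N\setminus j)\cdot}^\top A_{(N\setminus j)\cdot}+B^\top B)$ and $\mathrm{MESP}(C/C_{jj},n-1-s)+\log(C_{jj})+\operatorname{ldet}(A^\top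 A+B^\top B)$ are exactly the same MESP instance with the same constant added to the objective; i.e. $C_0=C/C_{jj}$ and the two added constants are equal.
   Context: $\operatorname{ldet}$ is the natural logarithm of the determinant. $A_{(N\setminus i)\cdot}$ is $A$ with row $i$ deleted, $A_{i\cdot}$ is row $i$ of $A$; $C_{N\setminus i,N\setminus i}$ is $C$ with row and column $i$ deleted. $C/C_{jj}$ is the Schur complement of the entry $C_{jj}$ in $C$, i.e. $C/C_{jj}=C_{N\setminus j,N\setminus j}-C_{N\setminus j,j}C_{jj}^{-1}C_{j,N\setminus j}$. A 0/1 D-Opt instance $\text{D-Opt}(A,B,s)$ is given by $A\in\mathbb{R}^{n\times m}$ with no all-zero rows, $B\in\mathbb{R}^{q\times m}$ ($q\ge1$), such that $\begin{pmatrix} A \\ B \end{pmatrix}$ has full column rank $m$, and a nonnegative integer $s$ with $n>s\ge m-\operatorname{rank}(B)$; the problem is to maximize $\operatorname{ldet}(A_{S\cdot}^\top A_{S\cdot}+B^\top B)$ over subsets $S$ of the row indices with $|S|=s$. $\mathrm{MESP}(C,t)$ is the problem of maximizing $\operatorname{ldet}(C_{T,T})$ over index sets $T$ with $|T|=t$. For $A$ with $k$ rows, the map $\mathcal{M}$ is $\mathcal{M}(\text{D-Opt}(A,B,s)):=\mathrm{MESP}(I_k-A(A^\top A+B^\top B)^{-1}A^\top,\,k-s)$. Adding a constant to a problem means adding it to the objective function. *)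

theory Defs
  imports
    "Jordan_Normal_Form.DL_Rank"
    "Jordan_Normal_Form.DL_Submatrix"
    "Jordan_Normal_Form.Gauss_Jordan_Elimination"
    "HOL-Library.Extended_Real"
begin

text \<open>Rows and columns are indexed from \<open>0\<close>.  Since \<open>submatrix\<close> renumbers the selected
  indices in increasing order, an object indexed by \<open>N\<close> without \<open>i\<close> appears here indexed
  by \<open>{0..<n - 1}\<close>, consistently on both sides of an equation.\<close>

definition ldet :: "real mat \<Rightarrow> real" where
  "ldet M = ln (det M)"

text \<open>The objectives are extended-real: a feasible set may select a singular matrix, where the
  value is \<open>-\<infinity>\<close>, whereas \<open>ln 0 = 0\<close> in HOL.\<close>

definition ldet_ext :: "real mat \<Rightarrow> ereal" where
  "ldet_ext M = (if 0 < det M then ereal (ldet M) else - \<infinity>)"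

definition delete_row :: "'a mat \<Rightarrow> nat \<Rightarrow> 'a mat" where
  "delete_row A i = submatrix A (- {i}) UNIV"

definition delete_row_col :: "'a mat \<Rightarrow> nat \<Rightarrow> 'a mat" where
  "delete_row_col C i = submatrix C (- {i}) (- {i})"

definition schur_complement_entry :: "real mat \<Rightarrow> nat \<Rightarrow> real mat" where
  "schur_complement_entry C j =
     delete_row_col C j
       - inverse (C $$ (j, j)) \<cdot>\<^sub>m (submatrix C (- {j}) {j} * submatrix C {j} (- {j}))"

text \<open>\<open>mat_inverse\<close> returns an option; only invertible arguments are of interest.\<close>

definition mat_inv :: "real mat \<Rightarrow> real mat" where
  "mat_inv M = the (mat_inverse M)"

text \<open>The rank of the library is relative to the space containing the columns.\<close>

definition mat_rank :: "real mat \<Rightarrow> nat" where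
  "mat_rank M = vec_space.rank (dim_row M) M"

definition gram_sum :: "real mat \<Rightarrow> real mat \<Rightarrow> real mat" where
  "gram_sum A B = A\<^sup>T * A + B\<^sup>T * B"

datatype dopt = DOpt "real mat" "real mat" nat

text \<open>The condition \<open>s \<ge> m - rank B\<close> is written additively to avoid truncated subtraction.\<close>

fun dopt_instance :: "nat \<Rightarrow> nat \<Rightarrow> nat \<Rightarrow> dopt \<Rightarrow> bool" where
  "dopt_instance n m q (DOpt A B s) \<longleftrightarrow>
     A \<in> carrier_mat n m \<and> (\<forall>i<n. row A i \<noteq> 0\<^sub>v m) \<and>
     B \<in> carrier_mat q m \<and> 1 \<le> q \<and>
     mat_rank (A @\<^sub>r B) = m \<and>
     s < n \<and> m \<le> s + mat_rank B"

fun dopt_feasible :: "dopt \<Rightarrow> nat set set" where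
  "dopt_feasible (DOpt A B s) = {S. S \<subseteq> {..<dim_row A} \<and> card S = s}"

fun dopt_objective :: "dopt \<Rightarrow> nat set \<Rightarrow> ereal" where
  "dopt_objective (DOpt A B s) S = ldet_ext (gram_sum (submatrix A S UNIV) B)"

datatype mesp = MESP "real mat" nat

fun mesp_feasible :: "mesp \<Rightarrow> nat set set" where
  "mesp_feasible (MESP C t) = {T. T \<subseteq> {..<dim_row C} \<and> card T = t}"

fun mesp_objective :: "mesp \<Rightarrow> nat set \<Rightarrow> ereal" where
  "mesp_objective (MESP C t) T = ldet_ext (submatrix C T T)"

text \<open>A MESP instance together with a constant added to its objective.  By injectivity of the
  constructors, equality means the same matrix, the same cardinality and the same constant.\<close>

datatype mesp_plus_const = Plus_Const mesp real  (infixl \<open>\<oplus>\<^sub>c\<close> 65)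

fun plus_const_feasible :: "mesp_plus_const \<Rightarrow> nat set set" where
  "plus_const_feasible (P \<oplus>\<^sub>c c) = mesp_feasible P"

fun plus_const_objective :: "mesp_plus_const \<Rightarrow> nat set \<Rightarrow> ereal" where
  "plus_const_objective (P \<oplus>\<^sub>c c) T = mesp_objective P T + ereal c"

fun dopt_to_mesp :: "dopt \<Rightarrow> mesp" where
  "dopt_to_mesp (DOpt A B s) =
     MESP (1\<^sub>m (dim_row A) - A * mat_inv (gram_sum A B) * A\<^sup>T) (dim_row A - s)"

text \<open>\<open>B\<close> with row \<open>i\<close> of \<open>A\<close> put on top.\<close>

definition prepend_row :: "real mat \<Rightarrow> nat \<Rightarrow> real mat \<Rightarrow> real mat" where
  "prepend_row A i B = mat_of_rows (dim_col A) [row A i] @\<^sub>r B"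

end

theory Submission
  imports Defs
begin

text \<open>Write \<open>M = A\<^sup>T A + B\<^sup>T B\<close>.  Moving row \<open>i\<close> of \<open>A\<close> into \<open>B\<close> leaves \<open>M\<close> unchanged, so the
  first reduction only selects a principal submatrix of \<open>C\<close>.  Dropping row \<open>a\<close> of \<open>A\<close> replaces
  \<open>M\<close> by \<open>M - a\<^sup>T a\<close>: the matrix determinant lemma multiplies the determinant by
  \<open>1 - a M\<^sup>-\<^sup>1 a\<^sup>T = C\<^sub>j\<^sub>j\<close>, and the rank-one correction of the inverse in the Woodbury identity is the
  correction term of the Schur complement.  Full column rank makes both Gram matrices
  nonsingular, whence \<open>C\<^sub>j\<^sub>j \<noteq> 0\<close>.\<close>

section \<open>Submatrices and the enumeration of index sets by \<open>pick\<close>\<close>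

lemma pick_less_card:
  assumes "k < card {i. i < n \<and> i \<in> I}"
  shows "pick I k < n" "pick I k \<in> I" "k < card I \<or> infinite I"
proof -
  show "pick I k < n" by (rule pick_le[OF assms])
  \<comment> \<open>The disjunction is the premise of \<open>pick_in_set\<close>. Index sets such as
    \<open>UNIV\<close> and \<open>- {i}\<close> are infinite, and their \<open>card\<close> is
    0.\<close>
  show "k < card I \<or> infinite I"
    using assms card_mono[of I "{i. i < n \<and> i \<in> I}"] by fastforce
  then show "pick I k \<in> I" by (rule pick_in_set)
qed

text \<open>Injectivity comes from strict monotonicity of \<open>pick\<close>. Domain and target
  have the same finite cardinality, so surjectivity follows without naming a preimage.\<close>

lemma bij_betw_pick:
  "bij_betw (pick I) {..<card {i. i < n \<and> i \<in> I}} {i. i < n \<and> i \<in> I}"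
proof -
  let ?S = "{i. i < n \<and> i \<in> I}"
  have inj: "inj_on (pick I) {..<card ?S}"
    by (intro inj_onI) (metis lessThan_iff nat_neq_iff pick_less_card(3) pick_mono)
  have sub: "pick I ` {..<card ?S} \<subseteq> ?S"
    using pick_less_card by blast
  have "pick I ` {..<card ?S} = ?S"
    by (rule card_subset_eq) (use sub inj in \<open>auto simp: card_image\<close>)
  with inj show ?thesis by (simp add: bij_betw_def)
qed

lemma sum_pick:
  "(\<Sum>k<card {i. i < n \<and> i \<in> I}. f (pick I k)) = sum f {i. i < n \<and> i \<in> I}"
  by (rule sum.reindex_bij_betw[OF bij_betw_pick])

text \<open>Serves \<open>gram_split\<close>: an entry of a Gram matrix is a sum over rows, cut here
  into two complementary sets of rows.\<close>

lemma sum_pick_compl: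
  fixes f :: "nat \<Rightarrow> 'a :: comm_monoid_add"
  shows "(\<Sum>k<n. f k) = (\<Sum>k<card {i. i < n \<and> i \<in> I}. f (pick I k)) +
    (\<Sum>k<card {i. i < n \<and> i \<in> - I}. f (pick (- I) k))"
proof -
  have "sum f ({i. i < n \<and> i \<in> I} \<union> {i. i < n \<and> i \<in> - I}) =
      sum f {i. i < n \<and> i \<in> I} + sum f {i. i < n \<and> i \<in> - I}"
    by (rule sum.union_disjoint) auto
  moreover have "{i. i < n \<and> i \<in> I} \<union> {i. i < n \<and> i \<in> - I} = {..<n}" by blast
  ultimately show ?thesis unfolding sum_pick by argo
qed

lemma card_less_in_singleton: "i < n \<Longrightarrow> card {k. k < n \<and> k \<in> {i}} = 1"
  by (subgoal_tac "{k. k < n \<and> k \<in> {i}} = {i}") auto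

lemma card_less_in_compl_singleton: "i < n \<Longrightarrow> card {k. k < n \<and> k \<in> - {i}} = n - 1"
  by (subgoal_tac "{k. k < n \<and> k \<in> - {i}} = {..<n} - {i}") auto

lemma pick_singleton: "pick {i} 0 = i"
  by (auto intro: Least_equality)

lemma submatrix_mult:
  assumes "A \<in> carrier_mat nr n" "B \<in> carrier_mat n nc"
  shows "submatrix (A * B) I J = submatrix A I UNIV * submatrix B UNIV J"
  using assms
  by (intro eq_matI)
    (auto simp: dim_submatrix submatrix_index pick_UNIV scalar_prod_def pick_less_card(1))

lemma submatrix_minus:
  assumes "A \<in> carrier_mat nr nc" "B \<in> carrier_mat nr nc"
  shows "submatrix (A - B) I J = submatrix A I J - submatrix B I J"
  using assms
  by (intro eq_matI) (auto simp: dim_submatrix submatrix_index pick_less_card(1))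

lemma submatrix_transpose: "submatrix A\<^sup>T I J = (submatrix A J I)\<^sup>T"
  by (intro eq_matI) (auto simp: dim_submatrix submatrix_index pick_less_card(1))

lemma submatrix_UNIV: "submatrix A UNIV UNIV = A"
  by (intro eq_matI) (auto simp: dim_submatrix submatrix_index pick_UNIV)

lemma submatrix_one_diag: "submatrix (1\<^sub>m n) I I = 1\<^sub>m (card {i. i < n \<and> i \<in> I})"
  by (intro eq_matI)
    (use bij_betw_imp_inj_on[OF bij_betw_pick[of I n]] in
      \<open>auto simp: dim_submatrix submatrix_index pick_less_card(1) dest: inj_onD\<close>)

text \<open>Removes the identity from the off-diagonal blocks of \<open>C\<close>: disjoint index
  sets never pick a diagonal position.\<close>

lemma submatrix_one_disjoint:
  assumes "I \<inter> J = {}"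
  shows "submatrix (1\<^sub>m n) I J =
    0\<^sub>m (card {i. i < n \<and> i \<in> I}) (card {j. j < n \<and> j \<in> J})"
proof (intro eq_matI)
  fix i j assume "i < dim_row (0\<^sub>m (card {i. i < n \<and> i \<in> I}) (card {j. j < n \<and> j \<in> J}))"
    "j < dim_col (0\<^sub>m (card {i. i < n \<and> i \<in> I}) (card {j. j < n \<and> j \<in> J}))"
  then have i: "i < card {i. i < n \<and> i \<in> I}" and j: "j < card {j. j < n \<and> j \<in> J}" by auto
  then have "pick I i \<noteq> pick J j"
    using pick_less_card(2)[OF i] pick_less_card(2)[OF j] assms by auto
  with i j show "submatrix (1\<^sub>m n) I J $$ (i, j) =
    0\<^sub>m (card {i. i < n \<and> i \<in> I}) (card {j. j < n \<and> j \<in> J}) $$ (i, j)"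
    using pick_less_card(1)[OF i] pick_less_card(1)[OF j] by (simp add: submatrix_index)
qed (auto simp: dim_submatrix)

section \<open>Gram matrices and full column rank\<close>

lemma gram_split:
  fixes A :: "'a :: comm_semiring_1 mat"
  shows "A\<^sup>T * A = (submatrix A I UNIV)\<^sup>T * submatrix A I UNIV +
    (submatrix A (- I) UNIV)\<^sup>T * submatrix A (- I) UNIV"
proof (intro eq_matI)
  fix k l
  assume "k < dim_row ((submatrix A I UNIV)\<^sup>T * submatrix A I UNIV +
      (submatrix A (- I) UNIV)\<^sup>T * submatrix A (- I) UNIV)"
    "l < dim_col ((submatrix A I UNIV)\<^sup>T * submatrix A I UNIV +
      (submatrix A (- I) UNIV)\<^sup>T * submatrix A (- I) UNIV)"
  then have kl: "k < dim_col A" "l < dim_col A" by (auto simp: dim_submatrix)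
  then show "(A\<^sup>T * A) $$ (k, l) = ((submatrix A I UNIV)\<^sup>T * submatrix A I UNIV +
      (submatrix A (- I) UNIV)\<^sup>T * submatrix A (- I) UNIV) $$ (k, l)"
    using sum_pick_compl[of "\<lambda>r. A $$ (r, k) * A $$ (r, l)" "dim_row A" I]
    by (simp add: dim_submatrix submatrix_index pick_UNIV scalar_prod_def lessThan_atLeast0)
qed (auto simp: dim_submatrix)

text \<open>Links the rank condition, stated for the stacked matrix, to the determinant of
  \<open>gram_sum\<close>.\<close>

lemma gram_append_rows:
  assumes A: "A \<in> carrier_mat n m" and B: "B \<in> carrier_mat q m"
  shows "(A @\<^sub>r B)\<^sup>T * (A @\<^sub>r B) = gram_sum A B"
proof -
  \<comment> \<open>\<open>append_rows\<close> is a block matrix whose right-hand blocks have no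
    columns. Block multiplication therefore applies, and the empty blocks vanish at the end.\<close>
  have T: "(A @\<^sub>r B)\<^sup>T = four_block_mat A\<^sup>T B\<^sup>T (0\<^sub>m 0 n) (0\<^sub>m 0 q)"
    using A B by (simp add: append_rows_def transpose_four_block_mat[of A n m _ 0 _ q])
  have "(A @\<^sub>r B)\<^sup>T * (A @\<^sub>r B) = four_block_mat (A\<^sup>T * A + B\<^sup>T * B)
      (A\<^sup>T * 0\<^sub>m n 0 + B\<^sup>T * 0\<^sub>m q 0) (0\<^sub>m 0 n * A + 0\<^sub>m 0 q * B)
      (0\<^sub>m 0 n * 0\<^sub>m n 0 + 0\<^sub>m 0 q * 0\<^sub>m q 0)"
    unfolding T unfolding append_rows_def
    using A B by (subst mult_four_block_mat[of _ m n _ q _ 0 _ _ m _ 0]) auto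
  also have "\<dots> = gram_sum A B"
    unfolding gram_sum_def by (intro eq_matI) (use A B in auto)
  finally show ?thesis .
qed

lemma (in vec_space) full_rank_kernel_trivial:
  assumes A: "A \<in> carrier_mat n nc" and r: "rank A = nc"
    and v: "v \<in> carrier_vec nc" and Av: "A *\<^sub>v v = 0\<^sub>v n"
  shows "v = 0\<^sub>v nc"
proof -
  \<comment> \<open>Linear dependence is stated for the set of columns, so repetitions must be
    excluded first. A repeated column would leave fewer than \<open>nc\<close> vectors, and the
    rank, being the size of a maximal independent subset, would be too small.\<close>
  have dist: "distinct (cols A)"
  proof (rule ccontr)
    assume "\<not> distinct (cols A)"
    then have less: "card (set (cols A)) < nc"
      using A card_length[of "cols A"] card_distinct[of "cols A"] by fastforce
    obtain S where S: "maximal S (\<lambda>T. T \<subseteq> set (cols A) \<and> lin_indpt T)"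
      using maximal_exists[of "(\<lambda>T. T \<subseteq> set (cols A) \<and> lin_indpt T)" "card (set (cols A))" "{}"]
      by (meson List.finite_set card_mono empty_iff empty_subsetI finite_lin_indpt2 rev_finite_subset)
    then have "card S \<le> card (set (cols A))" by (simp add: card_mono maximal_def)
    with rank_card_indpt[OF A S] less r show False by simp
  qed
  show ?thesis
    using full_rank_lin_indpt[OF A r dist] lin_depI[OF A v _ Av dist] by blast
qed

text \<open>Over the reals, a vector \<open>v\<close> in the kernel of the Gram matrix satisfies
  |Av|^2 = 0, hence lies in the kernel of \<open>A\<close>, which full column rank makes
  trivial.\<close>

lemma det_gram_neq_0:
  fixes A :: "real mat"
  assumes A: "A \<in> carrier_mat n m" and r: "mat_rank A = m"
  shows "det (A\<^sup>T * A) \<noteq> 0"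
proof
  assume "det (A\<^sup>T * A) = 0"
  then obtain v where v: "v \<in> carrier_vec m" "v \<noteq> 0\<^sub>v m" and 0: "A\<^sup>T * A *\<^sub>v v = 0\<^sub>v m"
    using det_0_iff_vec_prod_zero_field[of "A\<^sup>T * A" m] A by auto
  have "(A *\<^sub>v v) \<bullet> (A *\<^sub>v v) = (A\<^sup>T *\<^sub>v (A *\<^sub>v v)) \<bullet> v"
    using A v by (simp add: transpose_vec_mult_scalar[OF A v(1)])
  also have "\<dots> = 0"
    using A v 0 by simp
  finally have "A *\<^sub>v v = 0\<^sub>v n"
    using conjugate_square_eq_0_vec[of "A *\<^sub>v v" n] A v by simp
  moreover have "vec_space.rank n A = m" using r A by (simp add: mat_rank_def)
  ultimately show False
    using vec_space.full_rank_kernel_trivial[OF A _ v(1)] v(2) by blast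
qed

section \<open>Inverses, and determinant and inverse after a low-rank update\<close>

lemma mat_inv_inverse:
  assumes M: "M \<in> carrier_mat m m" and d: "det M \<noteq> 0"
  shows "mat_inv M \<in> carrier_mat m m" "M * mat_inv M = 1\<^sub>m m" "mat_inv M * M = 1\<^sub>m m"
proof -
  have "M \<in> Units (ring_mat TYPE(real) m ())"
    \<comment> \<open>Being a unit rules out the result \<open>None\<close>, so \<open>the\<close>
      in \<open>mat_inv\<close> is applied to a genuine inverse. The \<open>()\<close> below only
      fills the spare slot of the ring record.\<close>
    by (rule det_non_zero_imp_unit[OF M d])
  then obtain X where X: "mat_inverse M = Some X"
    using mat_inverse(1)[OF M, where b = "()"] by (cases "mat_inverse M") auto
  show "mat_inv M \<in> carrier_mat m m" "M * mat_inv M = 1\<^sub>m m" "mat_inv M * M = 1\<^sub>m m"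
    using mat_inverse(2)[OF M X] by (auto simp: mat_inv_def X)
qed

text \<open>A one-sided inverse suffices, since \<open>M * W = 1\<^sub>m m\<close> already forces a
  nonzero determinant. The Woodbury identity thus needs checking on one side only.\<close>

lemma mat_inv_eqI:
  assumes M: "M \<in> carrier_mat m m" and W: "W \<in> carrier_mat m m" and MW: "M * W = 1\<^sub>m m"
  shows "mat_inv M = W"
proof -
  have "det M * det W = 1" using det_mult[OF M W] MW by simp
  then have "det M \<noteq> 0" by auto
  note X = mat_inv_inverse[OF M this]
  have "mat_inv M = mat_inv M * (M * W)" using X MW by simp
  also have "\<dots> = mat_inv M * M * W" by (rule assoc_mult_mat[OF X(1) M W, symmetric])
  also have "\<dots> = W" using X W by simp
  finally show ?thesis .
qed

text \<open>Both factorizations eliminate one off-diagonal block of the matrix with rows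
  \<open>(M, U)\<close> and \<open>(V, 1)\<close>.\<close>

lemma det_minus_mult:
  fixes M :: "'a :: idom mat"
  assumes M: "M \<in> carrier_mat m m" and W: "W \<in> carrier_mat m m" and MW: "M * W = 1\<^sub>m m"
    and U: "U \<in> carrier_mat m p" and V: "V \<in> carrier_mat p m"
  shows "det (M - U * V) = det M * det (1\<^sub>m p - V * W * U)"
proof -
  let ?P = "four_block_mat M U V (1\<^sub>m p)"
  let ?L = "four_block_mat (1\<^sub>m m) (0\<^sub>m m p) (- V) (1\<^sub>m p)"
  let ?R = "four_block_mat (1\<^sub>m m) (- (W * U)) (0\<^sub>m p m) (1\<^sub>m p)"
  have P: "?P \<in> carrier_mat (m + p) (m + p)" and L: "?L \<in> carrier_mat (m + p) (m + p)"
    and R: "?R \<in> carrier_mat (m + p) (m + p)" using M by auto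
  have detL: "det ?L = 1"
    using V by (subst det_four_block_mat_upper_right_zero) auto
  have detR: "det ?R = 1"
    using W U by (subst det_four_block_mat_lower_left_zero) auto
  have MWU: "M * (W * U) = U"
    using assoc_mult_mat[OF M W U] U by (simp add: MW)
  have VWU: "V * (W * U) = V * W * U"
    using assoc_mult_mat[OF V W U] by simp
  have "U * - V = - (U * V)" and "M + - (U * V) = M - U * V" and "V + - V = 0\<^sub>m p m"
    using M U V by (auto intro!: eq_matI)
  then have PL: "?P * ?L = four_block_mat (M - U * V) U (0\<^sub>m p m) (1\<^sub>m p)"
    unfolding mult_four_block_mat[OF M U V one_carrier_mat one_carrier_mat zero_carrier_mat
        uminus_carrier_mat[OF V] one_carrier_mat]
    using M U V by simp
  have "M * - (W * U) + U = 0\<^sub>m m p"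
    using M W U MWU by simp
  moreover have "V * - (W * U) + 1\<^sub>m p = 1\<^sub>m p - V * (W * U)"
    using V W U by (simp, intro eq_matI) auto
  ultimately have PR: "?P * ?R = four_block_mat M (0\<^sub>m m p) V (1\<^sub>m p - V * W * U)"
    unfolding mult_four_block_mat[OF M U V one_carrier_mat one_carrier_mat
        uminus_carrier_mat[OF mult_carrier_mat[OF W U]] zero_carrier_mat one_carrier_mat]
    using M U V VWU by simp
  have "det (M - U * V) = det (?P * ?L)"
    unfolding PL using M U V by (subst det_four_block_mat_lower_left_zero) auto
  also have "\<dots> = det (?P * ?R)"
    using det_mult[OF P L] det_mult[OF P R] detL detR by simp
  also have "\<dots> = det M * det (1\<^sub>m p - V * W * U)"
    unfolding PR using M U V W by (subst det_four_block_mat_upper_right_zero) auto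
  finally show ?thesis .
qed

text \<open>The key is (M - UV)WU = U(1 - VWU): multiplying by \<open>K\<close> on the right leaves
  \<open>U\<close>. The correction term therefore contributes UVW, exactly what (M - UV)W = 1 - UVW
  is short of the identity.\<close>

lemma woodbury:
  fixes M :: "'a :: comm_ring_1 mat"
  assumes M: "M \<in> carrier_mat m m" and W: "W \<in> carrier_mat m m" and MW: "M * W = 1\<^sub>m m"
    and U: "U \<in> carrier_mat m p" and V: "V \<in> carrier_mat p m"
    and K: "K \<in> carrier_mat p p" and inv: "(1\<^sub>m p - V * W * U) * K = 1\<^sub>m p"
  shows "(M - U * V) * (W + W * U * K * (V * W)) = 1\<^sub>m m"
proof -
  have X: "V * W \<in> carrier_mat p m" and Z: "W * U \<in> carrier_mat m p"
    and UV: "U * V \<in> carrier_mat m m" and D: "M - U * V \<in> carrier_mat m m"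
    and Y: "V * W * U \<in> carrier_mat p p"
    using M U V W by auto
  have MZ: "M * (W * U) = U"
    using assoc_mult_mat[OF M W U] U by (simp add: MW)
  have "(M - U * V) * (W * U) = U - U * V * (W * U)"
    unfolding minus_mult_distrib_mat[OF M UV Z] MZ ..
  also have "U * V * (W * U) = U * (V * W * U)"
    unfolding assoc_mult_mat[OF U V Z] assoc_mult_mat[OF V W U] ..
  also have "U - U * (V * W * U) = U * (1\<^sub>m p - V * W * U)"
    using mult_minus_distrib_mat[OF U one_carrier_mat Y] U by simp
  finally have DZ: "(M - U * V) * (W * U) = U * (1\<^sub>m p - V * W * U)" .
  have "(M - U * V) * (W * U * K) = (M - U * V) * (W * U) * K"
    by (rule assoc_mult_mat[OF D Z K, symmetric])
  also have "\<dots> = U * ((1\<^sub>m p - V * W * U) * K)"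
    unfolding DZ by (rule assoc_mult_mat[OF U minus_carrier_mat[OF Y] K])
  also have "\<dots> = U" unfolding inv using U by simp
  finally have DZK: "(M - U * V) * (W * U * K) = U" .
  have "(M - U * V) * W = 1\<^sub>m m - U * (V * W)"
    unfolding minus_mult_distrib_mat[OF M UV W] MW assoc_mult_mat[OF U V W] ..
  moreover have "(M - U * V) * (W * U * K * (V * W)) = U * (V * W)"
    unfolding assoc_mult_mat[OF D mult_carrier_mat[OF Z K] X, symmetric] DZK ..
  ultimately have "(M - U * V) * (W + W * U * K * (V * W)) =
      1\<^sub>m m - U * (V * W) + U * (V * W)"
    using mult_add_distrib_mat[OF D W mult_carrier_mat[OF mult_carrier_mat[OF Z K] X]] by simp
  also have "\<dots> = 1\<^sub>m m"
    using U X by (intro eq_matI) auto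
  finally show ?thesis .
qed

section \<open>Deleting a row, and the blocks of \<open>C\<close>\<close>

lemma submatrix_carrier:
  "A \<in> carrier_mat n m \<Longrightarrow>
    submatrix A I J \<in> carrier_mat (card {i. i < n \<and> i \<in> I}) (card {j. j < m \<and> j \<in> J})"
  by (auto simp: dim_submatrix)

lemma delete_row_carrier:
  assumes "A \<in> carrier_mat n m" "i < n"
  shows "delete_row A i \<in> carrier_mat (n - 1) m"
proof -
  have "card {j. j < m \<and> j \<in> UNIV} = m" by simp
  with submatrix_carrier[OF assms(1), of "- {i}" UNIV] show ?thesis
    unfolding delete_row_def card_less_in_compl_singleton[OF assms(2)] by argo
qed

lemma submatrix_row_carrier:
  assumes "A \<in> carrier_mat n m" "i < n"
  shows "submatrix A {i} UNIV \<in> carrier_mat 1 m"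
proof -
  have "card {j. j < m \<and> j \<in> UNIV} = m" by simp
  with submatrix_carrier[OF assms(1), of "{i}" UNIV] show ?thesis
    unfolding card_less_in_singleton[OF assms(2)] by argo
qed

lemma submatrix_row_index:
  assumes "i < dim_row A" "l < dim_col A"
  shows "submatrix A {i} UNIV $$ (0, l) = A $$ (i, l)"
  using assms card_less_in_singleton[OF assms(1)]
  by (subst submatrix_index) (auto simp only: pick_UNIV pick_singleton, simp_all)

text \<open>Passes from 1-by-1 matrices to scalars: in this form the determinant and the inverse can
  be read off.\<close>

lemma submatrix_entry:
  fixes A :: "'a :: semiring_1 mat"
  assumes "i < dim_row A" "j < dim_col A"
  shows "submatrix A {i} {j} = A $$ (i, j) \<cdot>\<^sub>m 1\<^sub>m 1"
proof -
  have r: "card {k. k < dim_row A \<and> k \<in> {i}} = 1" and c: "card {k. k < dim_col A \<and> k \<in> {j}} = 1"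
    using card_less_in_singleton assms by blast+
  have "submatrix A {i} {j} $$ (0, 0) = A $$ (i, j)"
    using submatrix_index[of 0 A "{i}" 0 "{j}"] unfolding r c pick_singleton by simp
  moreover have "submatrix A {i} {j} \<in> carrier_mat 1 1"
    using submatrix_carrier[OF carrier_matI[OF refl refl], of A "{i}" "{j}"] unfolding r c .
  ultimately show ?thesis
    by (intro eq_matI) auto
qed

lemma mat_of_rows_row_eq_submatrix:
  assumes "A \<in> carrier_mat n m" "i < n"
  shows "mat_of_rows m [row A i] = submatrix A {i} UNIV"
proof (intro eq_matI)
  note car = submatrix_row_carrier[OF assms]
  fix k l assume "k < dim_row (submatrix A {i} UNIV)" "l < dim_col (submatrix A {i} UNIV)"
  with car have "k = 0" "l < m" by auto
  with assms show "mat_of_rows m [row A i] $$ (k, l) = submatrix A {i} UNIV $$ (k, l)"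
    by (simp add: submatrix_row_index mat_of_rows_def)
qed (use submatrix_row_carrier[OF assms] in auto)

lemma gram_delete_row:
  fixes A :: "'a :: comm_semiring_1 mat"
  shows "A\<^sup>T * A =
    (submatrix A {i} UNIV)\<^sup>T * submatrix A {i} UNIV + (delete_row A i)\<^sup>T * delete_row A i"
  unfolding delete_row_def by (rule gram_split)

lemma gram_sum_carrier:
  "A \<in> carrier_mat n m \<Longrightarrow> B \<in> carrier_mat q m \<Longrightarrow> gram_sum A B \<in> carrier_mat m m"
  by (auto simp: gram_sum_def)

lemma gram_sum_prepend_row:
  assumes A: "A \<in> carrier_mat n m" and B: "B \<in> carrier_mat q m" and i: "i < n"
  shows "gram_sum (delete_row A i) (prepend_row A i B) = gram_sum A B"
proof -
  note A' = delete_row_carrier[OF A i] and a = submatrix_row_carrier[OF A i]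
  let ?a = "submatrix A {i} UNIV"
  have "prepend_row A i B = ?a @\<^sub>r B"
    using A by (simp add: prepend_row_def mat_of_rows_row_eq_submatrix[OF A i])
  then have "gram_sum (delete_row A i) (prepend_row A i B) =
      (delete_row A i)\<^sup>T * delete_row A i + (?a\<^sup>T * ?a + B\<^sup>T * B)"
    using gram_append_rows[OF a B] by (simp add: gram_sum_def)
  also have "\<dots> = gram_sum A B"
    unfolding gram_sum_def gram_delete_row[of A i]
    by (intro eq_matI) (use A' a B in auto)
  finally show ?thesis .
qed

lemma gram_sum_delete_row:
  assumes A: "A \<in> carrier_mat n m" and B: "B \<in> carrier_mat q m" and i: "i < n"
  shows "gram_sum (delete_row A i) B =
    gram_sum A B - (submatrix A {i} UNIV)\<^sup>T * submatrix A {i} UNIV"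
  unfolding gram_sum_def gram_delete_row[of A i]
  by (intro eq_matI) (use delete_row_carrier[OF A i] submatrix_row_carrier[OF A i] B in auto)

text \<open>Row selection acts on the left factor only and column selection on the right one. This
  single formula yields the four blocks of \<open>C\<close> around a pivot.\<close>

lemma submatrix_one_minus_quadratic:
  fixes A :: "'a :: comm_ring_1 mat"
  assumes A: "A \<in> carrier_mat n m" and W: "W \<in> carrier_mat m m"
  shows "submatrix (1\<^sub>m n - A * W * A\<^sup>T) I J =
    submatrix (1\<^sub>m n) I J - submatrix A I UNIV * W * (submatrix A J UNIV)\<^sup>T"
proof -
  have AW: "A * W \<in> carrier_mat n m" and AT: "A\<^sup>T \<in> carrier_mat m n"
    using A W by auto
  show ?thesis
    unfolding submatrix_minus[OF one_carrier_mat mult_carrier_mat[OF AW AT]]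
      submatrix_mult[OF AW AT] submatrix_mult[OF A W] submatrix_transpose submatrix_UNIV ..
qed

lemma det_gram_sum_neq_0:
  assumes A: "A \<in> carrier_mat n m" and B: "B \<in> carrier_mat q m" and r: "mat_rank (A @\<^sub>r B) = m"
  shows "det (gram_sum A B) \<noteq> 0"
  using det_gram_neq_0[OF carrier_append_rows[OF A B] r] gram_append_rows[OF A B] by simp

theorem theorem38:
  fixes A B C :: "real mat" and n m q s :: nat
  assumes inst: "dopt_instance n m q (DOpt A B s)"
    and C: "dopt_to_mesp (DOpt A B s) = MESP C (n - s)"
  shows
    "(\<forall>i<n. 1 \<le> s \<longrightarrow>
        dopt_to_mesp (DOpt (delete_row A i) (prepend_row A i B) (s - 1))
            \<oplus>\<^sub>c ldet (gram_sum (delete_row A i) (prepend_row A i B))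
          = MESP (delete_row_col C i) (n - s) \<oplus>\<^sub>c ldet (gram_sum A B)) \<and>
     (\<forall>j<n. mat_rank (delete_row A j @\<^sub>r B) = m \<longrightarrow> s + 2 \<le> n \<longrightarrow>
        dopt_to_mesp (DOpt (delete_row A j) B s)
            \<oplus>\<^sub>c ldet (gram_sum (delete_row A j) B)
          = MESP (schur_complement_entry C j) (n - 1 - s)
            \<oplus>\<^sub>c (ln (C $$ (j, j)) + ldet (gram_sum A B)))"
proof -
  have A: "A \<in> carrier_mat n m" and B: "B \<in> carrier_mat q m"
    and rk: "mat_rank (A @\<^sub>r B) = m" and sn: "s < n"
    using inst by auto
  define M W where "M = gram_sum A B" and "W = mat_inv M"
  have M: "M \<in> carrier_mat m m"
    unfolding M_def by (rule gram_sum_carrier[OF A B])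
  have dM: "det M \<noteq> 0"
    unfolding M_def by (rule det_gram_sum_neq_0[OF A B rk])
  note W = mat_inv_inverse[OF M dM, folded W_def]
  have C_eq: "C = 1\<^sub>m n - A * W * A\<^sup>T"
    using C A by (simp add: M_def W_def)
  note C_sub = submatrix_one_minus_quadratic[OF A W(1), folded C_eq]
  have C_del: "delete_row_col C i =
      1\<^sub>m (n - 1) - delete_row A i * W * (delete_row A i)\<^sup>T" if "i < n" for i
    unfolding delete_row_col_def delete_row_def C_sub submatrix_one_diag
      card_less_in_compl_singleton[OF that] ..
  \<comment> \<open>The Gram sum is unchanged, so both sides use the same \<open>W\<close>. The
    cardinalities agree because (n - 1) - (s - 1) = n - s, where \<open>1 \<le> s\<close> keeps the
    truncated subtraction exact.\<close>
  have part1: "dopt_to_mesp (DOpt (delete_row A i) (prepend_row A i B) (s - 1))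
      \<oplus>\<^sub>c ldet (gram_sum (delete_row A i) (prepend_row A i B))
    = MESP (delete_row_col C i) (n - s) \<oplus>\<^sub>c ldet (gram_sum A B)" if i: "i < n" and s: "1 \<le> s" for i
    using delete_row_carrier[OF A i] s sn
    by (simp add: gram_sum_prepend_row[OF A B i] C_del[OF i] M_def W_def)
  have part2: "dopt_to_mesp (DOpt (delete_row A j) B s) \<oplus>\<^sub>c ldet (gram_sum (delete_row A j) B)
    = MESP (schur_complement_entry C j) (n - 1 - s) \<oplus>\<^sub>c (ln (C $$ (j, j)) + ldet (gram_sum A B))"
    if j: "j < n" and rk': "mat_rank (delete_row A j @\<^sub>r B) = m" for j
  proof -
    \<comment> \<open>The deleted row is kept as a 1-by-m matrix \<open>a\<close>, so the update
      lemmas apply with \<open>p = 1\<close>, \<open>U = a\<^sup>T\<close> and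
      \<open>V = a\<close>.\<close>
    define A' a c where "A' = delete_row A j" and "a = submatrix A {j} UNIV" and "c = C $$ (j, j)"
    have A': "A' \<in> carrier_mat (n - 1) m" and a: "a \<in> carrier_mat 1 m"
      unfolding A'_def a_def using delete_row_carrier[OF A j] submatrix_row_carrier[OF A j] .
    have aT: "a\<^sup>T \<in> carrier_mat m 1" and A'T: "A'\<^sup>T \<in> carrier_mat m (n - 1)"
      using a A' by auto
    have M0: "gram_sum A' B = M - a\<^sup>T * a"
      unfolding M_def A'_def a_def by (rule gram_sum_delete_row[OF A B j])
    \<comment> \<open>The 1-by-1 factor of the determinant lemma, also the matrix to be inverted in
      \<open>woodbury\<close>, is the diagonal block of \<open>C\<close> at
      \<open>j\<close>.\<close>
    have aWa: "1\<^sub>m 1 - a * W * a\<^sup>T = c \<cdot>\<^sub>m 1\<^sub>m 1"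
    proof -
      have "1\<^sub>m 1 - a * W * a\<^sup>T = submatrix C {j} {j}"
        unfolding C_sub submatrix_one_diag card_less_in_singleton[OF j] a_def ..
      also have "\<dots> = c \<cdot>\<^sub>m 1\<^sub>m 1"
        unfolding c_def using j A by (intro submatrix_entry) (auto simp: C_eq)
      finally show ?thesis .
    qed
    have det0: "det (gram_sum A' B) = c * det M"
      unfolding M0 det_minus_mult[OF M W(1,2) aT a] aWa by simp
    have "det (gram_sum A' B) \<noteq> 0"
      using det_gram_sum_neq_0[OF _ B] A' rk' unfolding A'_def by blast
    with det0 have c: "c \<noteq> 0" by auto
    \<comment> \<open>As a multiple of the identity, \<open>K\<close> lets the factor 1/c be pulled
      out of the products below.\<close>
    define K where "K = inverse c \<cdot>\<^sub>m (1\<^sub>m 1 :: real mat)"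
    have K: "K \<in> carrier_mat 1 1" by (simp add: K_def)
    have "(1\<^sub>m 1 - a * W * a\<^sup>T) * K = 1\<^sub>m 1"
      unfolding aWa K_def using c by (intro eq_matI) (auto simp: scalar_prod_def)
    note wood = woodbury[OF M W(1,2) aT a K this]
    have aW: "a * W \<in> carrier_mat 1 m" and WaT: "W * a\<^sup>T \<in> carrier_mat m 1"
      using a W(1) by auto
    note R = mult_carrier_mat[OF mult_carrier_mat[OF WaT K] aW]
    have inv: "mat_inv (gram_sum A' B) = W + W * a\<^sup>T * K * (a * W)"
      unfolding M0
      by (rule mat_inv_eqI[OF minus_carrier_mat[OF mult_carrier_mat[OF aT a]]
            add_carrier_mat[OF R] wood])
    have AW: "A' * W \<in> carrier_mat (n - 1) m" using A' W(1) by auto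
    have aWA: "a * W * A'\<^sup>T \<in> carrier_mat 1 (n - 1)" and AWa: "A' * W * a\<^sup>T \<in> carrier_mat (n - 1) 1"
      using aW A'T AW aT by auto
    have WK: "W * a\<^sup>T * K = inverse c \<cdot>\<^sub>m (W * a\<^sup>T)"
      unfolding K_def mult_smult_distrib[OF WaT one_carrier_mat] right_mult_one_mat[OF WaT] ..
    \<comment> \<open>Regrouping turns the Woodbury correction into 1/c times a column times a row,
      the shape of the Schur correction.\<close>
    have "A' * (W * a\<^sup>T * K * (a * W)) * A'\<^sup>T =
        inverse c \<cdot>\<^sub>m ((A' * (W * a\<^sup>T)) * (a * W) * A'\<^sup>T)"
      unfolding WK mult_smult_assoc_mat[OF WaT aW]
        mult_smult_distrib[OF A' mult_carrier_mat[OF WaT aW]]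
        mult_smult_assoc_mat[OF mult_carrier_mat[OF A' mult_carrier_mat[OF WaT aW]] A'T]
        assoc_mult_mat[OF A' WaT aW] ..
    also have "(A' * (W * a\<^sup>T)) * (a * W) * A'\<^sup>T = (A' * W * a\<^sup>T) * (a * W * A'\<^sup>T)"
      unfolding assoc_mult_mat[OF A' W(1) aT, symmetric] by (rule assoc_mult_mat[OF AWa aW A'T])
    finally have quad: "A' * (W + W * a\<^sup>T * K * (a * W)) * A'\<^sup>T =
        A' * W * A'\<^sup>T + inverse c \<cdot>\<^sub>m ((A' * W * a\<^sup>T) * (a * W * A'\<^sup>T))"
      unfolding mult_add_distrib_mat[OF A' W(1) R]
        add_mult_distrib_mat[OF AW mult_carrier_mat[OF A' R] A'T] by simp
    have disj: "- {j} \<inter> {j} = {}" "{j} \<inter> - {j} = {}" by auto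
    have colj: "submatrix C (- {j}) {j} = 0\<^sub>m (n - 1) 1 - A' * W * a\<^sup>T"
      unfolding C_sub A'_def a_def delete_row_def
        submatrix_one_disjoint[OF disj(1)] card_less_in_compl_singleton[OF j]
        card_less_in_singleton[OF j] ..
    have rowj: "submatrix C {j} (- {j}) = 0\<^sub>m 1 (n - 1) - a * W * A'\<^sup>T"
      unfolding C_sub A'_def a_def delete_row_def
        submatrix_one_disjoint[OF disj(2)] card_less_in_compl_singleton[OF j]
        card_less_in_singleton[OF j] ..
    \<comment> \<open>Column and row of \<open>C\<close> each carry a minus sign, and the two signs
      cancel in the product.\<close>
    have colrow: "submatrix C (- {j}) {j} * submatrix C {j} (- {j}) = (A' * W * a\<^sup>T) * (a * W * A'\<^sup>T)"
    proof -
      have neg: "(0\<^sub>m p q - X) * (0\<^sub>m q r - Y) = X * Y"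
        if "X \<in> carrier_mat p q" "Y \<in> carrier_mat q r" for X Y :: "real mat" and p q r
        using that by (intro eq_matI) (auto simp: scalar_prod_def)
      show ?thesis unfolding colj rowj by (rule neg[OF AWa aWA])
    qed
    have schur: "1\<^sub>m (n - 1) - A' * mat_inv (gram_sum A' B) * A'\<^sup>T = schur_complement_entry C j"
      unfolding schur_complement_entry_def colrow C_del[OF j, folded A'_def] inv quad c_def[symmetric]
      using mult_carrier_mat[OF AW A'T] mult_carrier_mat[OF AWa aWA] by (intro eq_matI) auto
    \<comment> \<open>On the reals, HOL's \<open>ln\<close> of a negative number is \<open>ln\<close> of its absolute value, so
      nonzero factors suffice here.\<close>
    have "ldet (gram_sum A' B) = ln c + ldet M"
      unfolding ldet_def det0 using c dM by (simp add: ln_mult)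
    then show ?thesis
      using schur A' by (simp add: A'_def[symmetric] c_def M_def)
  qed
  show ?thesis
    using part1 part2 by blast
qed

end
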